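(* If $T$ is a tree of order $n$ at least $2$ with $n_1$ endvertices, then $$s\ell_t(T)\geq \frac{n+2-n_1}{2}.$$
   Context: All graphs are finite, simple, and undirected. An endvertex is a vertex of degree $1$. For a graph $G$ of order $n\geq 1$ with non-increasing degree sequence $d_1\geq \ldots\geq d_n$, let $s\ell_t(G)=\min\{ s: d_1+\cdots+d_s\geq n\}$. *)

theory Defs
  imports "Graph_Theory.Digraph_Component" "HOL-Library.Multiset" Complex_Main
begin

text \<open>
  Finite simple undirected graphs are the symmetric loop-free digraphs without parallel arcs of
  the locale \<^locale>\<open>Digraph.graph\<close>: an edge between two vertices is a pair of opposite arcs.
  Hence the edges at a vertex correspond to the arcs leaving it, and its degree is
  \<^const>\<open>out_degree\<close>.
\<close>

lemma out_degree_eq_card_neighbours: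
  assumes "Digraph.graph G"
  shows "out_degree G v = card {u. v \<rightarrow>\<^bsub>G\<^esub> u}"
proof -
  interpret G: Digraph.graph G by (fact assms)
  have "inj_on (head G) (out_arcs G v)"
    by (rule inj_onI) (auto intro: G.no_multi_arcs simp: arc_to_ends_def)
  moreover have "head G ` out_arcs G v = {u. v \<rightarrow>\<^bsub>G\<^esub> u}"
    by (auto simp: arcs_ends_conv)
  ultimately show ?thesis
    unfolding out_degree_def by (metis card_image)
qed

text \<open>
  In a symmetric digraph the two arcs of a single edge already form a directed cycle of length 2,
  so \<^const>\<open>Digraph_Component.tree\<close>, which forbids every directed cycle, cannot be used. The
  cycles of the undirected graph are the directed cycles of length at least 3. Note that
  \<^const>\<open>Digraph_Component.connected\<close> excludes the graph without vertices.
\<close>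

definition undirected_tree :: "('a, 'b) pre_digraph \<Rightarrow> bool" where
  "undirected_tree G \<longleftrightarrow>
     Digraph.graph G \<and> Digraph_Component.connected G \<and>
     \<not> (\<exists>p. pre_digraph.cycle G p \<and> length p \<ge> 3)"

definition endvertices :: "('a, 'b) pre_digraph \<Rightarrow> 'a set" where
  "endvertices G = {v \<in> verts G. out_degree G v = 1}"

definition degree_sequence :: "('a, 'b) pre_digraph \<Rightarrow> nat list" where
  "degree_sequence G =
     rev (sorted_list_of_multiset (image_mset (out_degree G) (mset_set (verts G))))"

text \<open>
  The least element below is determined only if the sum of all degrees is at least the order of
  the graph, as it is for every tree with at least two vertices.
\<close>

definition sl_t :: "('a, 'b) pre_digraph \<Rightarrow> nat" where
  "sl_t G = (LEAST s. s \<le> card (verts G) \<and>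
                      card (verts G) \<le> sum_list (take s (degree_sequence G)))"

end

theory Submission
  imports Defs
begin

text \<open>
  The degrees of a tree of order \<open>n\<close> sum up to at most \<open>2n - 2\<close>. If \<open>s\<close> terms of
  the degree sequence sum up to at least \<open>n\<close>, then the remaining \<open>n - s\<close> terms sum up
  to at most \<open>n - 2\<close>. These are all at least \<open>1\<close>, and all but at most \<open>n\<^sub>1\<close> of them are
  at least \<open>2\<close>, whence \<open>2(n - s) - n\<^sub>1 \<le> n - 2\<close>.
\<close>

text \<open>Each entry \<open>x\<close> satisfies \<open>2 \<le> x\<close>, unless
  \<open>x = 1\<close>, and then its occurrence in the count supplies the missing unit.\<close>

lemma two_length_le_sum_list_plus_count_list:
  fixes xs :: "nat list"
  assumes "\<And>x. x \<in> set xs \<Longrightarrow> 1 \<le> x"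
  shows "2 * length xs \<le> sum_list xs + count_list xs 1"
  using assms
proof (induction xs)
  case (Cons x xs)
  have "1 \<le> x" and "2 * length xs \<le> sum_list xs + count_list xs 1"
    using Cons by auto
  then show ?case by auto
qed simp

context Digraph.graph
begin

lemma finite_neighbours: "finite {w. v \<rightarrow>\<^bsub>G\<^esub> w}"
  by (rule finite_subset[OF _ finite_verts]) (auto simp: arcs_ends_conv)

lemma neighbours_sym: "v \<rightarrow>\<^bsub>G\<^esub> w \<longleftrightarrow> w \<rightarrow>\<^bsub>G\<^esub> v"
  using graph_symmetric by blast

text \<open>
  At the start \<open>u\<close> of a longest path in \<open>S\<close>, all neighbours in \<open>S\<close> lie on the path, and one other
  than the second vertex of the path would close a cycle.
\<close>

lemma ex_vertex_at_most_one_neighbour_in: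
  assumes acyclic: "\<not> (\<exists>p. cycle p \<and> length p \<ge> 3)"
    and S: "S \<subseteq> verts G" "S \<noteq> {}"
  shows "\<exists>u\<in>S. card ({w. u \<rightarrow>\<^bsub>G\<^esub> w} \<inter> S) \<le> 1"
proof -
  \<comment> \<open>A path is coded by its start and its arc list. The end stays existential because
    paths are only lengthened in front.\<close>
  define P where "P = (\<lambda>(u, p). \<exists>v. apath u p v \<and> set (awalk_verts u p) \<subseteq> S)"
  have finS: "finite S" using S(1) finite_verts by (rule finite_subset)
  obtain a where "a \<in> S" using S(2) by blast
  then have "apath a [] a" and "set (awalk_verts a []) \<subseteq> S"
    using S(1) by (auto simp: apath_Nil_iff)
  then have "P (a, [])" by (auto simp: P_def)
  moreover have "length (snd x) \<le> card S" if "P x" for x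
  proof -
    obtain u p where x: "x = (u, p)" by fastforce
    then have "distinct (awalk_verts u p)" "set (awalk_verts u p) \<subseteq> S"
      using that by (auto simp: P_def apath_def)
    then have "length (awalk_verts u p) \<le> card S"
      using finS by (metis card_mono distinct_card)
    then show ?thesis using x by (simp add: length_awalk_verts)
  qed
  ultimately obtain x where x: "P x" "\<And>y. P y \<Longrightarrow> length (snd y) \<le> length (snd x)"
    using ex_has_greatest_nat[of P "(a, [])" "length \<circ> snd" "Suc (card S)"]
    by (auto simp: less_Suc_eq_le)
  obtain u p where up: "x = (u, p)" by fastforce
  obtain v where v: "apath u p v" and sub: "set (awalk_verts u p) \<subseteq> S"
    using x(1) up by (auto simp: P_def)
  have walk: "awalk u p v" and dist: "distinct (awalk_verts u p)"
    using v by (auto simp: apath_def)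
  have uS: "u \<in> S" using hd_in_awalk_verts(1)[OF walk] sub by blast
  \<comment> \<open>For \<open>p = []\<close> the value \<open>hd p\<close> is unspecified, but then
    \<open>u\<close> has no neighbour in \<open>S\<close> and the claim is vacuous.\<close>
  have "w = head G (hd p)" if uw: "u \<rightarrow>\<^bsub>G\<^esub> w" and wS: "w \<in> S" for w
  proof (rule ccontr)
    assume neq: "w \<noteq> head G (hd p)"
    have "w \<rightarrow>\<^bsub>G\<^esub> u" using uw neighbours_sym by blast
    then obtain e where e: "e \<in> arcs G" "tail G e = w" "head G e = u"
      by (auto simp: arcs_ends_conv)
    have wu: "w \<noteq> u" using no_loops[OF e(1)] e(2,3) by simp
    have "w \<in> set (awalk_verts u p)"
    proof (rule ccontr)
      assume "w \<notin> set (awalk_verts u p)"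
      then have "apath w (e # p) v" using e v by (simp add: apath_Cons_iff)
      moreover have "set (awalk_verts w (e # p)) \<subseteq> S" using e wS sub by simp
      ultimately have "P (w, e # p)" by (auto simp: P_def)
      then show False using x(2)[of "(w, e # p)"] up by simp
    qed
    \<comment> \<open>The initial piece \<open>q\<close> runs from \<open>u\<close> to
      \<open>w\<close>, so the arc \<open>e\<close> from \<open>w\<close> back to \<open>u\<close>
      closes it to a cycle.\<close>
    then obtain q r where qr: "p = q @ r" "awalk u q w" "awalk w r v"
      using awalk_decomp[OF walk] by blast
    have "distinct (awalk_verts u q)"
      using dist walk qr by (simp add: awalk_verts_append)
    moreover have "awalk w (e # q) w" using qr e by (simp add: awalk_Cons_iff)
    ultimately have "cycle (e # q)" unfolding cycle_def using e by auto
    \<comment> \<open>This rules out the harmless 2-cycle of opposite arcs: \<open>q = []\<close>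
      would give \<open>w = u\<close>, and a single arc would make \<open>w\<close> the second
      vertex of the path.\<close>
    moreover have "2 \<le> length q"
    proof (cases q)
      case Nil
      then show ?thesis using qr(2) wu by (auto simp: awalk_Nil_iff)
    next
      case (Cons b q')
      then show ?thesis using qr(1,2) neq by (cases q') (auto simp: awalk_simps)
    qed
    ultimately show False using acyclic by auto
  qed
  then have "{w. u \<rightarrow>\<^bsub>G\<^esub> w} \<inter> S \<subseteq> {head G (hd p)}" by blast
  then have "card ({w. u \<rightarrow>\<^bsub>G\<^esub> w} \<inter> S) \<le> 1"
    using card_mono[of "{head G (hd p)}"] by fastforce
  then show ?thesis using uS by blast
qed

text \<open>The sum is twice the number of edges induced by \<open>S\<close>. Deleting a vertex with
  at most one neighbour in \<open>S\<close> loses at most one edge. Working with vertex sets lets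
  the induction proceed inside the fixed graph, where acyclicity persists and connectedness of
  \<open>S\<close> need not.\<close>

lemma acyclic_sum_neighbours_in_le:
  assumes acyclic: "\<not> (\<exists>p. cycle p \<and> length p \<ge> 3)"
    and "S \<subseteq> verts G" "S \<noteq> {}"
  shows "(\<Sum>v\<in>S. card ({w. v \<rightarrow>\<^bsub>G\<^esub> w} \<inter> S)) + 2 \<le> 2 * card S"
  using assms(2,3)
proof (induction "card S" arbitrary: S rule: less_induct)
  case less
  let ?N = "\<lambda>v. {w. v \<rightarrow>\<^bsub>G\<^esub> w}"
  have fin: "finite S" using less.prems(1) finite_verts by (rule finite_subset)
  obtain u where u: "u \<in> S" "card (?N u \<inter> S) \<le> 1"
    using ex_vertex_at_most_one_neighbour_in[OF acyclic less.prems] by blast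
  define S' where "S' = S - {u}"
  have S': "S = insert u S'" "u \<notin> S'" "finite S'" using u fin by (auto simp: S'_def)
  have uu: "\<not> u \<rightarrow>\<^bsub>G\<^esub> u" using adj_not_same by blast
  show ?case
  proof (cases "S' = {}")
    case True
    then show ?thesis using S' uu by simp
  next
    case False
    have IH: "(\<Sum>v\<in>S'. card (?N v \<inter> S')) + 2 \<le> 2 * card S'"
      using less.hyps[of S'] less.prems False S' by auto
    have split: "card (?N v \<inter> S) = card (?N v \<inter> S') + (if v \<in> ?N u then 1 else 0)" for v
      using S' neighbours_sym[of u v] by (auto simp: Int_insert_right)
    have "(\<Sum>v\<in>S'. if v \<in> ?N u then 1 else (0::nat)) = card (?N u \<inter> S')"
      using S'(3) by (simp add: sum.If_cases Int_commute)
    moreover have "card (?N u \<inter> S') = card (?N u \<inter> S)"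
      using split[of u] uu by simp
    moreover have "(\<Sum>v\<in>S'. card (?N v \<inter> S)) =
        (\<Sum>v\<in>S'. card (?N v \<inter> S')) + (\<Sum>v\<in>S'. if v \<in> ?N u then 1 else 0)"
      by (simp only: split sum.distrib)
    \<comment> \<open>An edge at \<open>u\<close> is counted once here and once in the term of
      \<open>u\<close> itself, so restoring \<open>u\<close> adds at most 2 in total, as does the
      right-hand side.\<close>
    ultimately have "(\<Sum>v\<in>S'. card (?N v \<inter> S)) \<le> (\<Sum>v\<in>S'. card (?N v \<inter> S')) + 1"
      using u(2) by linarith
    then show ?thesis using IH S' u(2) by simp
  qed
qed

lemma acyclic_sum_out_degree_le:
  assumes "\<not> (\<exists>p. cycle p \<and> length p \<ge> 3)" and "verts G \<noteq> {}"
  shows "(\<Sum>v\<in>verts G. out_degree G v) + 2 \<le> 2 * card (verts G)"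
proof -
  have "out_degree G v = card ({w. v \<rightarrow>\<^bsub>G\<^esub> w} \<inter> verts G)" for v
    unfolding out_degree_eq_card_neighbours[OF graph_axioms]
    by (rule arg_cong[of _ _ card]) (auto simp: arcs_ends_conv)
  then show ?thesis
    using acyclic_sum_neighbours_in_le[OF assms(1) subset_refl assms(2)] by simp
qed

text \<open>A walk to some second vertex has to leave \<open>v\<close> by an arc.\<close>

lemma connected_out_degree_pos:
  assumes "connected G" and "2 \<le> card (verts G)" and v: "v \<in> verts G"
  shows "1 \<le> out_degree G v"
proof -
  have "verts G \<noteq> {v}" using assms(2) by auto
  then obtain w where w: "w \<in> verts G" "w \<noteq> v" using v by blast
  have "strongly_connected G"
    using symmetric_connected_imp_strongly_connected[OF sym_arcs assms(1)] .
  then have "v \<rightarrow>\<^sup>*\<^bsub>G\<^esub> w" using v w by blast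
  then obtain x where "v \<rightarrow>\<^bsub>G\<^esub> x" using w by (auto elim: converse_reachable_cases)
  then have "card {x. v \<rightarrow>\<^bsub>G\<^esub> x} \<noteq> 0" using finite_neighbours by auto
  then show ?thesis using out_degree_eq_card_neighbours[OF graph_axioms, of v] by linarith
qed

end

lemma mset_degree_sequence:
  "mset (degree_sequence G) = image_mset (out_degree G) (mset_set (verts G))"
  by (simp add: degree_sequence_def)

lemma length_degree_sequence: "length (degree_sequence G) = card (verts G)"
  using arg_cong[OF mset_degree_sequence, of size G] by simp

lemma sum_list_degree_sequence: "sum_list (degree_sequence G) = (\<Sum>v\<in>verts G. out_degree G v)"
  using arg_cong[OF mset_degree_sequence, of sum_mset G]
  by (simp only: sum_mset_sum_list sum_unfold_sum_mset)

lemma set_degree_sequence: "finite (verts G) \<Longrightarrow> set (degree_sequence G) = out_degree G ` verts G"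
  using arg_cong[OF mset_degree_sequence, of set_mset G] by simp

lemma count_list_degree_sequence:
  "finite (verts G) \<Longrightarrow> count_list (degree_sequence G) d = card {v \<in> verts G. out_degree G v = d}"
  using arg_cong[OF mset_degree_sequence, of "\<lambda>M. count M d" G]
  by (simp add: count_mset count_image_mset' Collect_conj_eq eq_commute[of d])

theorem theorem9:
  fixes T :: "('a, 'b) pre_digraph" and n n\<^sub>1 :: nat
  assumes "undirected_tree T"
    and "n = card (verts T)" and "n \<ge> 2"
    and "n\<^sub>1 = card (endvertices T)"
  shows "real (sl_t T) \<ge> (real n + 2 - real n\<^sub>1) / 2"
proof -
  interpret Digraph.graph T using assms(1) by (simp add: undirected_tree_def)
  let ?d = "degree_sequence T" and ?s = "sl_t T"
  have ne: "verts T \<noteq> {}" using assms(2,3) by auto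
  have ge1: "1 \<le> x" if "x \<in> set ?d" for x
    using that assms connected_out_degree_pos
    by (auto simp: set_degree_sequence undirected_tree_def)
  have len: "length ?d = n" using assms(2) by (simp add: length_degree_sequence)
  have total: "sum_list ?d + 2 \<le> 2 * n"
    using acyclic_sum_out_degree_le[OF _ ne] assms(1,2)
    by (simp add: sum_list_degree_sequence undirected_tree_def)
  \<comment> \<open>Since all degrees are positive, \<open>s = n\<close> meets the condition under
    \<open>LEAST\<close> in \<open>sl_t\<close>, so that the least element exists and meets it
    too.\<close>
  have "length ?d \<le> sum_list ?d"
    using sum_list_mono[of ?d "\<lambda>_. 1" "\<lambda>x. x"] ge1 by (simp add: sum_list_triv)
  then have "n \<le> card (verts T) \<and> card (verts T) \<le> sum_list (take n ?d)"
    using len assms(2) by simp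
  then have "?s \<le> card (verts T) \<and> card (verts T) \<le> sum_list (take ?s ?d)"
    unfolding sl_t_def
    by (rule LeastI[where P = "\<lambda>s. s \<le> card (verts T) \<and> card (verts T) \<le> sum_list (take s ?d)"])
  then have s: "?s \<le> n" "n \<le> sum_list (take ?s ?d)" using assms(2) by simp_all
  have "2 * length (drop ?s ?d) \<le> sum_list (drop ?s ?d) + count_list (drop ?s ?d) 1"
    using ge1 by (intro two_length_le_sum_list_plus_count_list) (auto dest: in_set_dropD)
  moreover have "sum_list (take ?s ?d) + sum_list (drop ?s ?d) = sum_list ?d"
    by (metis append_take_drop_id sum_list_append)
  \<comment> \<open>Endvertices may also occur among the first \<open>?s\<close> terms, so the
    remaining terms contain at most \<open>n\<^sub>1\<close> ones.\<close>
  moreover have "count_list (take ?s ?d) 1 + count_list (drop ?s ?d) 1 = n\<^sub>1"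
    using assms(4) count_list_degree_sequence[of T 1] finite_verts
    by (metis append_take_drop_id count_list_append endvertices_def)
  ultimately have "n + 2 \<le> 2 * ?s + n\<^sub>1" using total s len by simp
  then have "real (n + 2) \<le> real (2 * ?s + n\<^sub>1)" by (simp only: of_nat_le_iff)
  then show ?thesis by simp
qed

end
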